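(* Let $n\ge 1$ and let $\sigma\in S_n$ be a permutation of $[n]=\{1,\dots,n\}$ with $\sigma(1)=1$. For each $d\ge1$ let $\lambda_d$ be the number of cycles of length $d$ of $\sigma$ (fixed points count as cycles of length $1$, so $\lambda_1\ge1$ and $\sum_d d\lambda_d=n$), and set $\mu_d=\sum_{e\mid d,\ e<d} e\lambda_e$. For integers $m,x,y$ put $f(m,x,y)=(mx+y)^{m-1}y$. Then the number of labeled trees on $[n]$, rooted at $1$, that are $\sigma$-invariant equals \[\lambda_1^{\lambda_1-2}\cdot\prod_{d\ge2,\ \lambda_d\neq0} f(\lambda_d,d,\mu_d).\]
   Context: A labeled tree on $[n]$ rooted at $1$ is a spanning tree on the vertex set $[n]$ with distinguished root vertex $1$. Such a tree is $\sigma$-invariant if for every edge $\{i,j\}$ of the tree, $\{\sigma(i),\sigma(j)\}$ is also an edge of the tree. When $\lambda_1=1$, the factor $\lambda_1^{\lambda_1-2}=1^{-1}$ is read as $1$. *)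

theory Defs
  imports Complex_Main "HOL-Combinatorics.Orbits"
begin

text \<open>
  A simple undirected graph on a vertex set \<open>V\<close> is given by its edge set, a set of
  two-element subsets of \<open>V\<close>. (The notion of tree in the AFP entry \<open>Graph_Theory\<close> is for
  digraphs: there a pair of opposite arcs already forms a cycle, so that it does not
  capture undirected trees.)
\<close>

definition simple_graph_on :: "'a set \<Rightarrow> 'a set set \<Rightarrow> bool" where
  "simple_graph_on V E \<longleftrightarrow> (\<forall>e\<in>E. e \<subseteq> V \<and> card e = 2)"

definition connected_graph_on :: "'a set \<Rightarrow> 'a set set \<Rightarrow> bool" where
  "connected_graph_on V E \<longleftrightarrow> V \<noteq> {} \<and> (\<forall>u\<in>V. \<forall>v\<in>V. (u, v) \<in> {(x, y). {x, y} \<in> E}\<^sup>*)"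

definition graph_cycle :: "'a set set \<Rightarrow> 'a list \<Rightarrow> bool" where
  "graph_cycle E xs \<longleftrightarrow> 3 \<le> length xs \<and> distinct xs \<and>
     (\<forall>i<length xs. {xs ! i, xs ! (Suc i mod length xs)} \<in> E)"

definition tree_on :: "'a set \<Rightarrow> 'a set set \<Rightarrow> bool" where
  "tree_on V E \<longleftrightarrow> simple_graph_on V E \<and> connected_graph_on V E \<and> \<not> (\<exists>xs. graph_cycle E xs)"

text \<open>A rooted tree is a pair consisting of its edge set and its root.\<close>

definition rooted_labeled_trees :: "nat \<Rightarrow> nat \<Rightarrow> (nat set set \<times> nat) set" where
  "rooted_labeled_trees n r = {(E, r) | E. tree_on {1..n} E \<and> r \<in> {1..n}}"

definition invariant_edges :: "('a \<Rightarrow> 'a) \<Rightarrow> 'a set set \<Rightarrow> bool" where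
  "invariant_edges \<sigma> E \<longleftrightarrow> (\<forall>i j. {i, j} \<in> E \<longrightarrow> {\<sigma> i, \<sigma> j} \<in> E)"

text \<open>The cycles of a permutation of \<open>{1..n}\<close> are counted through its orbits on \<open>{1..n}\<close>.\<close>

definition num_cycles :: "nat \<Rightarrow> (nat \<Rightarrow> nat) \<Rightarrow> nat \<Rightarrow> nat" where
  "num_cycles n \<sigma> d = card {C \<in> orbit \<sigma> ` {1..n}. card C = d}"

definition mu :: "nat \<Rightarrow> (nat \<Rightarrow> nat) \<Rightarrow> nat \<Rightarrow> nat" where
  "mu n \<sigma> d = (\<Sum>e | e dvd d \<and> e < d. e * num_cycles n \<sigma> e)"

text \<open>The value is rational since the exponent \<open>m - 1\<close> may be negative.\<close>

definition tree_factor :: "int \<Rightarrow> int \<Rightarrow> int \<Rightarrow> rat" where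
  "tree_factor m x y = of_int (m * x + y) powi (m - 1) * of_int y"

end

theory Submission
  imports Defs "HOL-Library.FuncSet" "HOL-Library.Transitive_Closure_Table"
begin

text \<open>
  A tree rooted at \<open>1\<close> is the same thing as a parent function without cycles, and the tree is
  \<open>\<sigma>\<close>-invariant iff its parent function commutes with \<open>\<sigma>\<close>. Such a function maps a cycle of length
  \<open>d\<close> onto a cycle of length dividing \<open>d\<close>, so it splits into independent pieces, one for each \<open>d\<close>:
  a forest on the \<open>\<lambda>\<^sub>d\<close> cycles of length \<open>d\<close>, where each cycle is attached either to another one of
  length \<open>d\<close> (\<open>d\<close> ways) or to one of the \<open>\<mu>\<^sub>d\<close> points on shorter cycles. The fixed points are treated
  alike, with \<open>\<lambda>\<^sub>1 - 1\<close> cycles and \<open>1\<close> as the only root. Classifying the forests with \<open>m\<close> cycles and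
  \<open>y\<close> root points by the set of cycles attached to the roots gives
  \<open>f(m,x,y) = \<Sum>\<^sub>k (m choose k) y\<^sup>k f(m-k,x,kx)\<close>, which the binomial theorem solves.
\<close>

text \<open>Equivalently, iterating \<open>p\<close> from any point of \<open>S\<close> leaves \<open>S\<close>.\<close>

definition rooted_on :: "'a set \<Rightarrow> ('a \<Rightarrow> 'a) \<Rightarrow> bool" where
  "rooted_on S p \<longleftrightarrow> (\<forall>X\<subseteq>S. X \<noteq> {} \<longrightarrow> (\<exists>v\<in>X. p v \<notin> X))"

definition equivariant_on :: "('a \<Rightarrow> 'a) \<Rightarrow> 'a set \<Rightarrow> ('a \<Rightarrow> 'a) \<Rightarrow> bool" where
  "equivariant_on \<sigma> S p \<longleftrightarrow> (\<forall>v\<in>S. p (\<sigma> v) = \<sigma> (p v))"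

definition parent_edges :: "'a set \<Rightarrow> ('a \<Rightarrow> 'a) \<Rightarrow> 'a set set" where
  "parent_edges S p = (\<lambda>v. {v, p v}) ` S"

section \<open>Induction and congruence for rooted and equivariant functions\<close>

lemma rooted_onD:
  "rooted_on S p \<Longrightarrow> X \<subseteq> S \<Longrightarrow> X \<noteq> {} \<Longrightarrow> \<exists>v\<in>X. p v \<notin> X"
  unfolding rooted_on_def by blast

lemma rooted_on_subset: "rooted_on S p \<Longrightarrow> T \<subseteq> S \<Longrightarrow> rooted_on T p"
  unfolding rooted_on_def by (simp add: subset_trans)

lemma rooted_on_cong: "(\<And>v. v \<in> S \<Longrightarrow> p v = q v) \<Longrightarrow> rooted_on S p \<longleftrightarrow> rooted_on S q"
  unfolding rooted_on_def by (simp add: subset_iff)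

lemma rooted_on_no_loop: "rooted_on S p \<Longrightarrow> v \<in> S \<Longrightarrow> p v \<noteq> v"
  using rooted_onD[of S p "{v}"] by auto

text \<open>Rootedness is well-foundedness of the step from a point to its parent. A nonempty set of
  counterexamples would contain some \<open>v\<close> whose parent lies outside it, so
  \<open>step\<close> would apply to \<open>v\<close>.\<close>

lemma rooted_on_induct [consumes 2, case_names parent]:
  assumes "rooted_on S p" and "v \<in> S"
    and step: "\<And>v. v \<in> S \<Longrightarrow> (p v \<in> S \<Longrightarrow> P (p v)) \<Longrightarrow> P v"
  shows "P v"
proof (rule ccontr)
  assume "\<not> P v"
  then have "{u \<in> S. \<not> P u} \<noteq> {}" using \<open>v \<in> S\<close> by auto
  then obtain u where "u \<in> S" "\<not> P u" "p u \<notin> {u \<in> S. \<not> P u}"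
    using rooted_onD[OF assms(1), of "{u \<in> S. \<not> P u}"] by auto
  then show False using step by blast
qed

lemma equivariant_on_subset: "equivariant_on \<sigma> S p \<Longrightarrow> T \<subseteq> S \<Longrightarrow> equivariant_on \<sigma> T p"
  unfolding equivariant_on_def by blast

text \<open>Equivariance at \<open>v\<close> also evaluates the function at
  \<open>\<sigma> v\<close>, hence the closure of \<open>S\<close>. The lemma serves to discard
  \<open>restrict\<close> on unions of orbits.\<close>

lemma equivariant_on_cong:
  assumes "\<And>v. v \<in> S \<Longrightarrow> p v = q v" and "\<sigma> ` S \<subseteq> S"
  shows "equivariant_on \<sigma> S p \<longleftrightarrow> equivariant_on \<sigma> S q"
  using assms unfolding equivariant_on_def by (metis image_subset_iff)

section \<open>Trees and parent functions\<close>

lemma parent_edges_simple: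
  assumes "rooted_on S p" and "p \<in> S \<rightarrow> insert r S"
  shows "simple_graph_on (insert r S) (parent_edges S p)"
  unfolding simple_graph_on_def parent_edges_def
proof (clarify)
  fix v assume v: "v \<in> S"
  have "v \<noteq> p v" using rooted_on_no_loop[OF assms(1) v] by simp
  then show "{v, p v} \<subseteq> insert r S \<and> card {v, p v} = 2" using v assms(2) by auto
qed

lemma parent_edges_reach_root:
  assumes "rooted_on S p" and "p \<in> S \<rightarrow> insert r S" and "v \<in> insert r S"
  shows "(v, r) \<in> {(x, y). {x, y} \<in> parent_edges S p}\<^sup>*"
proof (cases "v = r")
  case False
  then have "v \<in> S" using assms(3) by simp
  with assms(1) show ?thesis
  proof (induction rule: rooted_on_induct)
    case (parent v)
    have "(v, p v) \<in> {(x, y). {x, y} \<in> parent_edges S p}"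
      using parent.hyps by (auto simp: parent_edges_def)
    moreover have "(p v, r) \<in> {(x, y). {x, y} \<in> parent_edges S p}\<^sup>*"
      using parent assms(2) by (cases "p v = r") auto
    ultimately show ?case by (rule converse_rtrancl_into_rtrancl)
  qed
qed simp

lemma sym_edge_relation: "sym {(x, y). {x, y} \<in> E}"
  by (auto simp: sym_def insert_commute)

lemma parent_edges_connected:
  assumes "rooted_on S p" and "p \<in> S \<rightarrow> insert r S"
  shows "connected_graph_on (insert r S) (parent_edges S p)"
  unfolding connected_graph_on_def
proof (intro conjI ballI)
  fix u v assume "u \<in> insert r S" "v \<in> insert r S"
  then have "(u, r) \<in> {(x, y). {x, y} \<in> parent_edges S p}\<^sup>*"
    and "(r, v) \<in> {(x, y). {x, y} \<in> parent_edges S p}\<^sup>*"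
    by (auto intro!: parent_edges_reach_root[OF assms] intro: symD[OF sym_rtrancl[OF sym_edge_relation]])
  then show "(u, v) \<in> {(x, y). {x, y} \<in> parent_edges S p}\<^sup>*" by (rule rtrancl_trans)
qed simp

text \<open>Two positions with the same edge are either equal or cyclic successors of each other,
  and the latter forces length at most 2. This supplies the edge count of a cycle.\<close>

lemma graph_cycle_edges_inj:
  assumes "3 \<le> length xs" and "distinct xs"
  shows "inj_on (\<lambda>i. {xs ! i, xs ! (Suc i mod length xs)}) {..<length xs}"
proof (rule inj_onI)
  fix i j assume ij: "i \<in> {..<length xs}" "j \<in> {..<length xs}"
    and eq: "{xs ! i, xs ! (Suc i mod length xs)} = {xs ! j, xs ! (Suc j mod length xs)}"
  let ?n = "length xs"
  have m: "Suc i mod ?n < ?n" "Suc j mod ?n < ?n" using assms(1) by (auto intro: mod_less_divisor)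
  have "i = j \<or> (i = Suc j mod ?n \<and> j = Suc i mod ?n)"
    using eq ij m assms(2) by (auto simp: doubleton_eq_iff nth_eq_iff_index_eq)
  moreover have "\<not> (i = Suc j mod ?n \<and> j = Suc i mod ?n)"
    using ij assms(1) by (auto simp: mod_Suc split: if_splits)
  ultimately show "i = j" by blast
qed

text \<open>A cycle on the vertex set \<open>X\<close> has \<open>card X\<close> edges, each joining some \<open>v \<in> X\<close> to its parent;
  hence every \<open>v \<in> X\<close> occurs and \<open>X\<close> is closed under taking parents.\<close>

lemma parent_edges_acyclic:
  assumes "rooted_on S p"
  shows "\<not> graph_cycle (parent_edges S p) xs"
proof
  assume "graph_cycle (parent_edges S p) xs"
  then have len: "3 \<le> length xs" and dist: "distinct xs"
    and edge: "\<And>i. i < length xs \<Longrightarrow> {xs ! i, xs ! (Suc i mod length xs)} \<in> parent_edges S p"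
    unfolding graph_cycle_def by auto
  let ?F = "(\<lambda>i. {xs ! i, xs ! (Suc i mod length xs)}) ` {..<length xs}"
  let ?Y = "{v \<in> set xs. v \<in> S \<and> p v \<in> set xs}"
  have "?F \<subseteq> (\<lambda>v. {v, p v}) ` ?Y"
  proof
    fix e assume "e \<in> ?F"
    then obtain i where i: "i < length xs" "e = {xs ! i, xs ! (Suc i mod length xs)}" by auto
    moreover have "Suc i mod length xs < length xs" using len by (intro mod_less_divisor) linarith
    ultimately have "e \<subseteq> set xs" by simp
    moreover obtain v where "v \<in> S" "e = {v, p v}"
      using edge[OF i(1)] i(2) by (auto simp: parent_edges_def)
    ultimately show "e \<in> (\<lambda>v. {v, p v}) ` ?Y" by auto
  qed
  then have "card ?F \<le> card ?Y"
    using card_mono[of "(\<lambda>v. {v, p v}) ` ?Y" ?F] card_image_le[of ?Y "\<lambda>v. {v, p v}"] by simp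
  moreover have "card ?F = card (set xs)"
    using card_image[OF graph_cycle_edges_inj[OF len dist]] dist by (simp add: distinct_card)
  ultimately have "?Y = set xs" by (intro card_seteq) auto
  moreover have "set xs \<noteq> {}" using len by auto
  ultimately show False using rooted_onD[OF assms, of "set xs"] by blast
qed

lemma tree_on_parent_edges:
  assumes "rooted_on S p" and "p \<in> S \<rightarrow> insert r S"
  shows "tree_on (insert r S) (parent_edges S p)"
  unfolding tree_on_def
  using parent_edges_simple[OF assms] parent_edges_connected[OF assms]
    parent_edges_acyclic[OF assms(1)] by blast

text \<open>Induction from the roots upwards: the edge \<open>{v, p v}\<close> arises from
  \<open>q\<close> either at \<open>v\<close>, as wanted, or at \<open>p v\<close>. In the second
  case \<open>q (p v) = v\<close>, and the induction hypothesis turns this into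
  \<open>p (p v) = v\<close>, a closed set \<open>{v, p v}\<close>. Inclusion is the form in which
  the comparison with the image of a tree under \<open>\<sigma>\<close> arises.\<close>

lemma parent_edges_subset_imp_eq:
  assumes p: "rooted_on S p" and sub: "parent_edges S p \<subseteq> parent_edges S q" and "v \<in> S"
  shows "p v = q v"
  using p \<open>v \<in> S\<close>
proof (induction rule: rooted_on_induct)
  case (parent v)
  have "{v, p v} \<in> parent_edges S q" using sub parent.hyps by (auto simp: parent_edges_def)
  then obtain u where u: "u \<in> S" "{v, p v} = {u, q u}" by (auto simp: parent_edges_def)
  show ?case
  proof (cases "u = v")
    case True
    then show ?thesis using u by (auto simp: doubleton_eq_iff)
  next
    case False
    then have "u = p v" "q u = v" using u by (auto simp: doubleton_eq_iff)
    then have "p (p v) = v" using parent.IH u(1) by simp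
    then have False
      using rooted_onD[OF p, of "{v, p v}"] parent.hyps u(1) \<open>u = p v\<close> by auto
    then show ?thesis ..
  qed
qed

text \<open>Shorten the walk to a path without repetitions. It has more than one step because
  \<open>{a, b}\<close> is not an edge, so with the new edge it closes up to a cycle of length at
  least 3.\<close>

lemma extra_edge_gives_cycle:
  assumes path: "(a, b) \<in> {(x, y). {x, y} \<in> E}\<^sup>*" and "a \<noteq> b" and "{a, b} \<notin> E"
  shows "\<exists>xs. graph_cycle (insert {a, b} E) xs"
proof -
  let ?r = "\<lambda>x y. {x, y} \<in> E"
  have "?r\<^sup>*\<^sup>* a b" using path by (simp add: rtranclp_rtrancl_eq)
  then obtain ys0 where "rtrancl_path ?r a ys0 b" by (auto simp: rtranclp_eq_rtrancl_path)
  then obtain ys where ys: "rtrancl_path ?r a ys b" and dist: "distinct (a # ys)"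
    by (rule rtrancl_path_distinct)
  have ne: "ys \<noteq> []" using ys \<open>a \<noteq> b\<close> by (auto elim: rtrancl_path.cases)
  have last: "last ys = b" using rtrancl_path_last[OF ys ne] .
  have "length ys \<noteq> 1"
  proof
    assume "length ys = 1"
    then have "ys = [b]" using last by (cases ys) auto
    then show False using rtrancl_path_nth[OF ys, of 0] \<open>{a, b} \<notin> E\<close> by simp
  qed
  moreover have "length ys \<noteq> 0" using ne by simp
  ultimately have "3 \<le> length (a # ys)" by (simp del: length_0_conv, arith)
  moreover have "{(a # ys) ! i, (a # ys) ! (Suc i mod length (a # ys))} \<in> insert {a, b} E"
    if "i < length (a # ys)" for i
  proof (cases "i = length ys")
    \<comment> \<open>The last position: its successor wraps around to \<open>a\<close>, and the
      edge is the added one.\<close>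
    case True
    then have "(a # ys) ! i = b" using last ne by (simp add: last_conv_nth nth_Cons')
    then show ?thesis using True by (simp add: insert_commute)
  next
    case False
    then have "i < length ys" using that by simp
    then show ?thesis using rtrancl_path_nth[OF ys, of i] by simp
  qed
  ultimately show ?thesis using dist unfolding graph_cycle_def by blast
qed

text \<open>The parent of \<open>v\<close> is a neighbour that is closer to \<open>r\<close>.\<close>

lemma connected_graph_parent_function:
  assumes con: "connected_graph_on (insert r S) E" and simple: "simple_graph_on (insert r S) E"
    and "r \<notin> S"
  obtains p where "p \<in> S \<rightarrow>\<^sub>E insert r S" "rooted_on S p" "parent_edges S p \<subseteq> E"
proof -
  let ?R = "{(x, y). {x, y} \<in> E}"
  define dist where "dist v = (LEAST k. (v, r) \<in> ?R ^^ k)" for v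
  have "\<exists>w. {v, w} \<in> E \<and> dist w < dist v" if "v \<in> S" for v
  proof -
    have "(v, r) \<in> ?R\<^sup>*" using con that unfolding connected_graph_on_def by blast
    then obtain k0 where "(v, r) \<in> ?R ^^ k0" by (auto simp: rtrancl_power)
    then have d: "(v, r) \<in> ?R ^^ dist v" unfolding dist_def by (rule LeastI)
    have "dist v \<noteq> 0"
    proof
      assume "dist v = 0"
      then show False using d that \<open>r \<notin> S\<close> by simp
    qed
    then obtain k where k: "dist v = Suc k" using not0_implies_Suc by blast
    then obtain w where "(v, w) \<in> ?R" "(w, r) \<in> ?R ^^ k"
      using d relpow_Suc_D2[of v r k ?R] by auto
    moreover from this have "dist w \<le> k" unfolding dist_def by (intro Least_le)
    ultimately show ?thesis using k by auto
  qed
  then obtain f where f: "\<And>v. v \<in> S \<Longrightarrow> {v, f v} \<in> E \<and> dist (f v) < dist v" by metis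
  show ?thesis
  proof
    have "f v \<in> insert r S" if "v \<in> S" for v
      using f[OF that] simple unfolding simple_graph_on_def by blast
    then show "restrict f S \<in> S \<rightarrow>\<^sub>E insert r S" by auto
    show "rooted_on S (restrict f S)"
      unfolding rooted_on_def
    proof (intro allI impI)
      fix X assume X: "X \<subseteq> S" "X \<noteq> {}"
      \<comment> \<open>A point of \<open>X\<close> at minimal distance from \<open>r\<close> has
        its parent strictly closer, hence outside \<open>X\<close>.\<close>
      then obtain v where "v \<in> X" "\<And>u. u \<in> X \<Longrightarrow> dist v \<le> dist u"
        using exists_least_iff[of "\<lambda>k. \<exists>v\<in>X. dist v = k"]
        by (metis ex_in_conv not_less)
      then show "\<exists>v\<in>X. restrict f S v \<notin> X"
        using X f by (metis not_less restrict_apply' subsetD)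
    qed
    show "parent_edges S (restrict f S) \<subseteq> E"
      using f by (auto simp: parent_edges_def)
  qed
qed

text \<open>The edges of a parent function inside \<open>E\<close> already connect all vertices, so
  any further edge of \<open>E\<close> would close a cycle.\<close>

lemma tree_on_parent_function:
  assumes tree: "tree_on (insert r S) E" and "r \<notin> S"
  obtains p where "p \<in> S \<rightarrow>\<^sub>E insert r S" "rooted_on S p" "E = parent_edges S p"
proof -
  have simple: "simple_graph_on (insert r S) E" and con: "connected_graph_on (insert r S) E"
    and acyc: "\<And>xs. \<not> graph_cycle E xs"
    using tree unfolding tree_on_def by auto
  obtain p where p: "p \<in> S \<rightarrow>\<^sub>E insert r S" "rooted_on S p" "parent_edges S p \<subseteq> E"
    using connected_graph_parent_function[OF con simple \<open>r \<notin> S\<close>] by blast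
  have "E \<subseteq> parent_edges S p"
  proof
    fix e assume e: "e \<in> E"
    then obtain a b where ab: "e = {a, b}" "a \<noteq> b" "a \<in> insert r S" "b \<in> insert r S"
      using simple unfolding simple_graph_on_def by (metis card_2_iff insert_subset)
    show "e \<in> parent_edges S p"
    proof (rule ccontr)
      assume "e \<notin> parent_edges S p"
      moreover have "(a, b) \<in> {(x, y). {x, y} \<in> parent_edges S p}\<^sup>*"
        using parent_edges_connected[OF p(2), of r] p(1) ab unfolding connected_graph_on_def by auto
      ultimately obtain xs where "graph_cycle (insert {a, b} (parent_edges S p)) xs"
        using extra_edge_gives_cycle ab by metis
      moreover have "insert {a, b} (parent_edges S p) \<subseteq> E" using p(3) e ab(1) by simp
      ultimately have "graph_cycle E xs" unfolding graph_cycle_def by (meson subsetD)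
      then show False using acyc by blast
    qed
  qed
  then show thesis using p that by blast
qed

text \<open>Conjugating \<open>p\<close> by \<open>\<sigma>\<close> yields the parent function
  \<open>q\<close> of the image tree, again rooted because \<open>\<sigma>\<close> fixes
  \<open>r\<close> and preserves \<open>S\<close>. Invariance puts the edges of \<open>q\<close>
  among those of \<open>p\<close>, so both functions agree on \<open>S\<close>, which is
  equivariance.\<close>

lemma invariant_parent_edges_iff:
  assumes \<sigma>: "\<sigma> permutes insert r S" and fix_r: "\<sigma> r = r" and "r \<notin> S"
    and p: "rooted_on S p" "p \<in> S \<rightarrow> insert r S"
  shows "invariant_edges \<sigma> (parent_edges S p) \<longleftrightarrow> equivariant_on \<sigma> S p"
proof
  have bij: "bij \<sigma>" using \<sigma> by (rule permutes_bij)
  have S: "\<sigma> v \<in> S \<longleftrightarrow> v \<in> S" for v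
    using permutes_in_image[OF \<sigma>, of v] fix_r \<open>r \<notin> S\<close> bij by (metis bij_pointE insert_iff)
  {
    assume inv: "invariant_edges \<sigma> (parent_edges S p)"
    define q where "q = \<sigma> \<circ> p \<circ> inv_into UNIV \<sigma>"
    have q: "q (\<sigma> v) = \<sigma> (p v)" for v
      using bij by (simp add: q_def bij_is_inj)
    have surj: "\<exists>u. v = \<sigma> u" for v using bij by (metis bij_pointE)
    have "rooted_on S q"
      unfolding rooted_on_def
    proof (intro allI impI)
      fix X assume X: "X \<subseteq> S" "X \<noteq> {}"
      have "\<sigma> -` X \<subseteq> S" using X S by auto
      moreover have "\<sigma> -` X \<noteq> {}"
        using X bij by (metis bij_is_surj image_empty image_vimage_eq inf_top.right_neutral)
      ultimately obtain v where "\<sigma> v \<in> X" "\<sigma> (p v) \<notin> X"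
        using rooted_onD[OF p(1), of "\<sigma> -` X"] by auto
      then show "\<exists>v\<in>X. q v \<notin> X" using q by metis
    qed
    moreover have "parent_edges S q \<subseteq> parent_edges S p"
    proof
      fix e assume "e \<in> parent_edges S q"
      then obtain v where v: "v \<in> S" "e = {v, q v}" by (auto simp: parent_edges_def)
      moreover obtain u where "v = \<sigma> u" using surj by blast
      ultimately have "u \<in> S" "e = {\<sigma> u, \<sigma> (p u)}" using q S by auto
      moreover from this have "{u, p u} \<in> parent_edges S p" by (auto simp: parent_edges_def)
      ultimately show "e \<in> parent_edges S p" using inv unfolding invariant_edges_def by blast
    qed
    ultimately have "q v = p v" if "v \<in> S" for v
      using parent_edges_subset_imp_eq that by metis
    then show "equivariant_on \<sigma> S p"
      unfolding equivariant_on_def using q S by metis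
  }
  assume eq: "equivariant_on \<sigma> S p"
  show "invariant_edges \<sigma> (parent_edges S p)"
    unfolding invariant_edges_def
  proof (intro allI impI)
    fix i j assume "{i, j} \<in> parent_edges S p"
    then obtain v where v: "v \<in> S" "{i, j} = {v, p v}" by (auto simp: parent_edges_def)
    then have "{\<sigma> i, \<sigma> j} = {\<sigma> v, p (\<sigma> v)}"
      using eq unfolding equivariant_on_def by (auto simp: doubleton_eq_iff)
    then show "{\<sigma> i, \<sigma> j} \<in> parent_edges S p" using v S by (auto simp: parent_edges_def)
  qed
qed

text \<open>The roots \<open>R\<close> are kept apart from \<open>S\<close> so that one notion
  covers both the whole tree, with \<open>R = {r}\<close>, and its pieces, with points of other
  cycles as roots. Extensionality makes each forest a single function, as counting requires.\<close>

definition equivariant_forests :: "('a \<Rightarrow> 'a) \<Rightarrow> 'a set \<Rightarrow> 'a set \<Rightarrow> ('a \<Rightarrow> 'a) set" where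
  "equivariant_forests \<sigma> S R = {p \<in> S \<rightarrow>\<^sub>E S \<union> R. equivariant_on \<sigma> S p \<and> rooted_on S p}"

lemma card_invariant_trees:
  assumes \<sigma>: "\<sigma> permutes insert r S" and fix_r: "\<sigma> r = r" and "r \<notin> S"
  shows "card {E. tree_on (insert r S) E \<and> invariant_edges \<sigma> E} =
    card (equivariant_forests \<sigma> S {r})"
proof -
  have "bij_betw (parent_edges S) (equivariant_forests \<sigma> S {r})
    {E. tree_on (insert r S) E \<and> invariant_edges \<sigma> E}"
  proof (rule bij_betw_imageI)
    show "inj_on (parent_edges S) (equivariant_forests \<sigma> S {r})"
    proof (rule inj_onI)
      fix p q
      assume pq: "p \<in> equivariant_forests \<sigma> S {r}" "q \<in> equivariant_forests \<sigma> S {r}"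
        and eq: "parent_edges S p = parent_edges S q"
      then have "p v = q v" if "v \<in> S" for v
        using parent_edges_subset_imp_eq[of S p q] that by (auto simp: equivariant_forests_def)
      then show "p = q"
        using pq by (auto simp: equivariant_forests_def intro: PiE_ext)
    qed
    show "parent_edges S ` equivariant_forests \<sigma> S {r} =
      {E. tree_on (insert r S) E \<and> invariant_edges \<sigma> E}"
    proof (intro equalityI subsetI)
      fix E assume "E \<in> parent_edges S ` equivariant_forests \<sigma> S {r}"
      then obtain p where "E = parent_edges S p" "p \<in> S \<rightarrow> insert r S" "rooted_on S p"
        "equivariant_on \<sigma> S p"
        by (auto simp: equivariant_forests_def)
      then show "E \<in> {E. tree_on (insert r S) E \<and> invariant_edges \<sigma> E}"
        using tree_on_parent_edges[of S p r] invariant_parent_edges_iff[OF assms, of p] by simp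
    next
      fix E assume E: "E \<in> {E. tree_on (insert r S) E \<and> invariant_edges \<sigma> E}"
      then obtain p where p: "p \<in> S \<rightarrow>\<^sub>E insert r S" "rooted_on S p" "E = parent_edges S p"
        using tree_on_parent_function[of r S E] \<open>r \<notin> S\<close> by auto
      then have "p \<in> equivariant_forests \<sigma> S {r}"
        using E invariant_parent_edges_iff[OF assms p(2)] by (auto simp: equivariant_forests_def)
      then show "E \<in> parent_edges S ` equivariant_forests \<sigma> S {r}" using p(3) by blast
    qed
  qed
  then show ?thesis by (rule bij_betw_same_card[symmetric])
qed

section \<open>Equivariant functions on orbits\<close>

lemma card_orbit_eq_funpow_dist1:
  assumes "permutation \<sigma>"
  shows "card (orbit \<sigma> x) = funpow_dist1 \<sigma> x x"
proof -
  have x: "x \<in> orbit \<sigma> x" using assms by (rule permutation_self_in_orbit)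
  show ?thesis
    by (subst orbit_conv_funpow_dist1[OF x], subst card_image[OF inj_on_funpow_dist1[OF x]]) simp
qed

text \<open>The orbit size is the first positive return time to \<open>x\<close>, so a return after
  \<open>k\<close> steps leaves remainder 0. This turns divisibility of cycle lengths into an
  equation that equivariant maps preserve.\<close>

lemma card_orbit_dvd_iff:
  assumes "permutation \<sigma>"
  shows "card (orbit \<sigma> x) dvd k \<longleftrightarrow> (\<sigma> ^^ k) x = x"
proof -
  let ?d = "card (orbit \<sigma> x)"
  have per: "(\<sigma> ^^ ?d) x = x"
    using funpow_dist1_prop[OF permutation_self_in_orbit[OF assms]] card_orbit_eq_funpow_dist1[OF assms]
    by metis
  have pos: "0 < ?d" using card_orbit_eq_funpow_dist1[OF assms] by simp
  have "(\<sigma> ^^ k) x = x \<longleftrightarrow> (\<sigma> ^^ (k mod ?d)) x = x"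
    using funpow_mod_eq[OF per] by metis
  also have "\<dots> \<longleftrightarrow> k mod ?d = 0"
    using funpow_dist1_least[of "k mod ?d" \<sigma> x x] pos card_orbit_eq_funpow_dist1[OF assms, of x]
    by (metis funpow_0 gr0I mod_less_divisor)
  finally show ?thesis by (simp add: dvd_eq_mod_eq_0)
qed

lemma card_orbit_pos: "permutation \<sigma> \<Longrightarrow> 0 < card (orbit \<sigma> x)"
  by (simp add: card_orbit_eq_funpow_dist1)

lemma orbits_disjoint:
  assumes "permutation \<sigma>" and "A \<in> range (orbit \<sigma>)" and "B \<in> range (orbit \<sigma>)" and "A \<noteq> B"
  shows "A \<inter> B = {}"
proof (rule ccontr)
  assume "A \<inter> B \<noteq> {}"
  then obtain x where "x \<in> A" "x \<in> B" by blast
  moreover have "cyclic_on \<sigma> A" "cyclic_on \<sigma> B" using assms(1-3) cyclic_on_orbit' by auto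
  ultimately show False using orbit_cyclic_eq3 \<open>A \<noteq> B\<close> by metis
qed

lemma image_Union_orbits:
  assumes "\<S> \<subseteq> range (orbit \<sigma>)"
  shows "\<sigma> ` \<Union>\<S> \<subseteq> \<Union>\<S>"
  using assms orbit.step[of _ \<sigma>] by (fastforce simp: subset_iff image_iff)

lemma finite_Union_orbits:
  assumes "permutation \<sigma>" and "finite \<S>" and "\<S> \<subseteq> range (orbit \<sigma>)"
  shows "finite (\<Union>\<S>)"
proof (rule finite_Union[OF assms(2)])
  fix A assume "A \<in> \<S>"
  then obtain x where "A = orbit \<sigma> x" using assms(3) by blast
  then show "finite A" using finite_orbit[OF permutation_self_in_orbit[OF assms(1)]] by simp
qed

lemma card_Union_orbits:
  assumes "permutation \<sigma>" and "\<S> \<subseteq> range (orbit \<sigma>)" and "\<And>A. A \<in> \<S> \<Longrightarrow> card A = d"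
  shows "card (\<Union>\<S>) = card \<S> * d"
proof -
  have "card (\<Union>\<S>) = sum card \<S>"
  proof (rule card_Union_disjoint)
    show "disjoint \<S>"
      unfolding pairwise_def disjnt_def
      by (intro ballI impI orbits_disjoint[OF assms(1)]) (use assms(2) in auto)
    show "finite A" if A: "A \<in> \<S>" for A
    proof -
      obtain x where "A = orbit \<sigma> x" using A assms(2) by blast
      then show ?thesis using finite_orbit[OF permutation_self_in_orbit[OF assms(1)]] by simp
    qed
  qed
  then show ?thesis using assms(3) by simp
qed

lemma equivariant_on_funpow:
  assumes "equivariant_on \<sigma> S p" and "\<sigma> ` S \<subseteq> S" and "v \<in> S"
  shows "p ((\<sigma> ^^ k) v) = (\<sigma> ^^ k) (p v)"
proof -
  have "(\<sigma> ^^ k) v \<in> S \<and> p ((\<sigma> ^^ k) v) = (\<sigma> ^^ k) (p v)"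
    using assms by (induction k) (auto simp: equivariant_on_def)
  then show ?thesis ..
qed

lemma funpow_image_subset:
  assumes "\<sigma> ` R \<subseteq> R" and "y \<in> R"
  shows "(\<sigma> ^^ k) y \<in> R"
  using assms by (induction k) auto

text \<open>For \<open>a \<le> b\<close>, injectivity of \<open>\<sigma> ^^ a\<close> reduces both
  equations to being fixed by \<open>\<sigma> ^^ (b - a)\<close>, which passes from \<open>x\<close>
  to \<open>y\<close> by divisibility. It makes the map sending \<open>(\<sigma> ^^ k) x\<close> to
  \<open>(\<sigma> ^^ k) y\<close> well defined.\<close>

lemma funpow_eq_transfer:
  assumes "permutation \<sigma>" and "card (orbit \<sigma> y) dvd card (orbit \<sigma> x)"
    and "(\<sigma> ^^ a) x = (\<sigma> ^^ b) x"
  shows "(\<sigma> ^^ a) y = (\<sigma> ^^ b) y"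
proof -
  have le: "(\<sigma> ^^ a) y = (\<sigma> ^^ b) y" if "a \<le> b" "(\<sigma> ^^ a) x = (\<sigma> ^^ b) x" for a b
  proof -
    have inj: "inj (\<sigma> ^^ a)"
      using bij_fn[OF permutation_bijective[OF assms(1)]] by (rule bij_is_inj)
    have split: "(\<sigma> ^^ b) z = (\<sigma> ^^ a) ((\<sigma> ^^ (b - a)) z)" for z
      using \<open>a \<le> b\<close> by (metis comp_apply funpow_add le_add_diff_inverse)
    then have "(\<sigma> ^^ (b - a)) x = x" using that(2) inj by (metis injD)
    then have "(\<sigma> ^^ (b - a)) y = y"
      using card_orbit_dvd_iff[OF assms(1)] assms(2) dvd_trans by metis
    then show ?thesis using split by simp
  qed
  show ?thesis
    using le[of a b] le[of b a] assms(3) by (metis nat_le_linear)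
qed

text \<open>Evaluation at \<open>x\<close> is a bijection onto \<open>R\<close>: the value there
  determines the map along the orbit, and the divisibility condition lets every value be
  extended.\<close>

lemma card_equivariant_on_orbit:
  assumes perm: "permutation \<sigma>" and R: "\<sigma> ` R \<subseteq> R"
    and dvd: "\<And>y. y \<in> R \<Longrightarrow> card (orbit \<sigma> y) dvd card (orbit \<sigma> x)"
  shows "card {q \<in> orbit \<sigma> x \<rightarrow>\<^sub>E R. equivariant_on \<sigma> (orbit \<sigma> x) q} = card R"
proof -
  let ?O = "orbit \<sigma> x" and ?Q = "{q \<in> orbit \<sigma> x \<rightarrow>\<^sub>E R. equivariant_on \<sigma> (orbit \<sigma> x) q}"
  have x: "x \<in> ?O" using perm by (rule permutation_self_in_orbit)
  have inv: "\<sigma> ` ?O \<subseteq> ?O" by (auto intro: orbit.step)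
  have pow: "(\<sigma> ^^ funpow_dist \<sigma> x u) x = u" if "u \<in> ?O" for u
    using that by (rule funpow_dist_prop)
  have "bij_betw (\<lambda>q. q x) ?Q R"
  proof (rule bij_betw_imageI)
    show "inj_on (\<lambda>q. q x) ?Q"
    proof (rule inj_onI)
      fix p q assume pq: "p \<in> ?Q" "q \<in> ?Q" "p x = q x"
      have "p u = q u" if "u \<in> ?O" for u
        using equivariant_on_funpow[OF _ inv x, of _ "funpow_dist \<sigma> x u"] pq pow[OF that]
        by (metis (mono_tags, lifting) mem_Collect_eq)
      then show "p = q" using pq by (auto intro: PiE_ext)
    qed
    show "(\<lambda>q. q x) ` ?Q = R"
    proof (intro equalityI subsetI)
      fix y assume "y \<in> (\<lambda>q. q x) ` ?Q" then show "y \<in> R" using x by auto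
    next
      fix y assume y: "y \<in> R"
      define q where "q = (\<lambda>u\<in>?O. (\<sigma> ^^ funpow_dist \<sigma> x u) y)"
      have "q (\<sigma> u) = \<sigma> (q u)" if "u \<in> ?O" for u
      proof -
        have su: "\<sigma> u \<in> ?O" using that by (rule orbit.step)
        \<comment> \<open>The two exponents differ when \<open>\<sigma> u = x\<close>, where
          \<open>funpow_dist\<close> falls back to 0; only their effect on \<open>x\<close>, and
          hence on \<open>y\<close>, agrees.\<close>
        have "(\<sigma> ^^ funpow_dist \<sigma> x (\<sigma> u)) x = (\<sigma> ^^ Suc (funpow_dist \<sigma> x u)) x"
          using pow[OF su] pow[OF that] by simp
        then have "(\<sigma> ^^ funpow_dist \<sigma> x (\<sigma> u)) y = (\<sigma> ^^ Suc (funpow_dist \<sigma> x u)) y"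
          by (rule funpow_eq_transfer[OF perm dvd[OF y]])
        then show ?thesis using that su by (simp add: q_def)
      qed
      moreover have "q \<in> ?O \<rightarrow>\<^sub>E R"
        using funpow_image_subset[OF R y] by (auto simp: q_def)
      ultimately have "q \<in> ?Q" by (simp add: equivariant_on_def)
      moreover have "q x = y" using x by (simp add: q_def funpow_dist_0)
      ultimately show "y \<in> (\<lambda>q. q x) ` ?Q" by blast
    qed
  qed
  then show ?thesis by (rule bij_betw_same_card)
qed

text \<open>Taking all restrictions is a bijection onto \<open>Pi\<^sub>E I F\<close>. Disjointness
  allows arbitrary pieces to be glued, and extensionality fixes the values off the domains.\<close>

lemma card_extensional_pieces:
  assumes "finite I" and disj: "\<And>i j. i \<in> I \<Longrightarrow> j \<in> I \<Longrightarrow> i \<noteq> j \<Longrightarrow> D i \<inter> D j = {}"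
    and F: "\<And>i. i \<in> I \<Longrightarrow> F i \<subseteq> extensional (D i)"
  shows "card {p \<in> extensional (\<Union>i\<in>I. D i). \<forall>i\<in>I. restrict p (D i) \<in> F i} = (\<Prod>i\<in>I. card (F i))"
proof -
  let ?P = "{p \<in> extensional (\<Union>i\<in>I. D i). \<forall>i\<in>I. restrict p (D i) \<in> F i}"
  let ?\<phi> = "\<lambda>p. \<lambda>i\<in>I. restrict p (D i)"
  have "bij_betw ?\<phi> ?P (Pi\<^sub>E I F)"
  proof (rule bij_betw_imageI)
    show "inj_on ?\<phi> ?P"
    proof (rule inj_onI)
      fix p q assume pq: "p \<in> ?P" "q \<in> ?P" "?\<phi> p = ?\<phi> q"
      have "p v = q v" if v: "v \<in> (\<Union>i\<in>I. D i)" for v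
      proof -
        obtain i where i: "i \<in> I" "v \<in> D i" using v by blast
        then have "restrict p (D i) = restrict q (D i)" using fun_cong[OF pq(3), of i] by simp
        then show ?thesis using i(2) by (metis restrict_apply')
      qed
      then show "p = q" using pq by (auto intro: extensionalityI)
    qed
    show "?\<phi> ` ?P = Pi\<^sub>E I F"
    proof (intro equalityI subsetI)
      fix g assume "g \<in> ?\<phi> ` ?P" then show "g \<in> Pi\<^sub>E I F" by auto
    next
      fix g assume g: "g \<in> Pi\<^sub>E I F"
      define p where "p = (\<lambda>v\<in>(\<Union>i\<in>I. D i). g (THE i. i \<in> I \<and> v \<in> D i) v)"
      have p: "restrict p (D i) = g i" if i: "i \<in> I" for i
      proof
        fix v
        show "restrict p (D i) v = g i v"
        proof (cases "v \<in> D i")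
          case True
          then have "(THE i. i \<in> I \<and> v \<in> D i) = i" using i disj by (intro the_equality) blast+
          then show ?thesis using True i by (auto simp: p_def)
        next
          case False
          moreover have "g i \<in> extensional (D i)" using g F[OF i] i by (meson PiE_mem subsetD)
          ultimately show ?thesis using extensional_arb[of "g i" "D i" v] by simp
        qed
      qed
      have "?\<phi> p = g"
      proof
        fix i show "?\<phi> p i = g i"
        proof (cases "i \<in> I")
          case True
          then show ?thesis using p by simp
        next
          case False
          then show ?thesis using PiE_arb[OF g False] by simp
        qed
      qed
      moreover have "p \<in> ?P" using p g by (auto simp: p_def)
      ultimately show "g \<in> ?\<phi> ` ?P" by blast
    qed
  qed
  then have "card ?P = card (Pi\<^sub>E I F)" by (rule bij_betw_same_card)
  then show ?thesis using card_PiE[OF \<open>finite I\<close>] by simp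
qed

lemma card_extensional_two_pieces:
  assumes "A \<inter> B = {}" and "F \<subseteq> extensional A" and "G \<subseteq> extensional B"
  shows "card {p \<in> extensional (A \<union> B). restrict p A \<in> F \<and> restrict p B \<in> G} = card F * card G"
proof -
  have "card {p \<in> extensional (\<Union>b\<in>UNIV. if b then A else B).
      \<forall>b\<in>UNIV. restrict p (if b then A else B) \<in> (if b then F else G)} =
    (\<Prod>b\<in>UNIV. card (if b then F else G))"
    by (rule card_extensional_pieces) (use assms in auto)
  moreover have "\<exists>b. b" by blast
  ultimately show ?thesis by (simp add: UNIV_bool Un_commute conj_commute mult.commute)
qed

text \<open>Orbits are disjoint and closed under \<open>\<sigma>\<close>, so equivariance is a
  separate condition on each and the choices multiply.\<close>

lemma card_equivariant_on_orbits:
  assumes perm: "permutation \<sigma>" and fin: "finite \<S>" and \<S>: "\<S> \<subseteq> range (orbit \<sigma>)"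
    and card: "\<And>A. A \<in> \<S> \<Longrightarrow> card A = d"
    and R: "\<sigma> ` R \<subseteq> R" and dvd: "\<And>y. y \<in> R \<Longrightarrow> card (orbit \<sigma> y) dvd d"
  shows "card {q \<in> \<Union>\<S> \<rightarrow>\<^sub>E R. equivariant_on \<sigma> (\<Union>\<S>) q} = card R ^ card \<S>"
proof -
  let ?F = "\<lambda>A. {q \<in> A \<rightarrow>\<^sub>E R. equivariant_on \<sigma> A q}"
  have inv: "\<sigma> ` A \<subseteq> A" if "A \<in> \<S>" for A
    using image_Union_orbits[of "{A}" \<sigma>] that \<S> by auto
  have cong: "equivariant_on \<sigma> A (restrict q A) \<longleftrightarrow> equivariant_on \<sigma> A q" if "A \<in> \<S>" for A q
    by (rule equivariant_on_cong[OF _ inv[OF that]]) simp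
  have eq: "equivariant_on \<sigma> (\<Union>\<S>) q \<longleftrightarrow> (\<forall>A\<in>\<S>. equivariant_on \<sigma> A q)" for q
    unfolding equivariant_on_def by blast
  have "{q \<in> \<Union>\<S> \<rightarrow>\<^sub>E R. equivariant_on \<sigma> (\<Union>\<S>) q} =
    {q \<in> extensional (\<Union>A\<in>\<S>. A). \<forall>A\<in>\<S>. restrict q A \<in> ?F A}"
    by (auto simp: eq cong PiE_def Pi_def)
  also have "card \<dots> = (\<Prod>A\<in>\<S>. card (?F A))"
  proof (rule card_extensional_pieces[OF fin])
    show "A \<inter> B = {}" if "A \<in> \<S>" "B \<in> \<S>" "A \<noteq> B" for A B
      by (rule orbits_disjoint[OF perm]) (use that \<S> in auto)
    show "?F A \<subseteq> extensional A" for A by (auto simp: PiE_def)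
  qed
  also have "\<dots> = (\<Prod>A\<in>\<S>. card R)"
  proof (rule prod.cong)
    fix A assume A: "A \<in> \<S>"
    then obtain x where "A = orbit \<sigma> x" using \<S> by blast
    moreover from this have "card (orbit \<sigma> x) = d" using card[OF A] by simp
    ultimately show "card (?F A) = card R"
      using card_equivariant_on_orbit[OF perm R, of x] dvd by simp
  qed simp
  finally show ?thesis by simp
qed

section \<open>Counting equivariant forests\<close>

text \<open>The empty forest is counted once; with truncated subtraction the general formula would
  give \<open>y\<close> at \<open>m = 0\<close>.\<close>

definition forest_number :: "nat \<Rightarrow> nat \<Rightarrow> nat \<Rightarrow> nat" where
  "forest_number m x y = (if m = 0 then 1 else (m * x + y) ^ (m - 1) * y)"

text \<open>Here \<open>k\<close> is the number of cycles attached directly to roots. Absorption,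
  \<open>k * (m choose k) = m * ((m - 1) choose (k - 1))\<close>, turns the sum into
  \<open>y\<close> times the binomial expansion of \<open>(y + m * x) ^ (m - 1)\<close>.\<close>

lemma forest_number_recurrence:
  assumes "0 < m"
  shows "(\<Sum>k\<le>m. (m choose k) * (y ^ k * forest_number (m - k) x (k * x))) = forest_number m x y"
proof -
  obtain n where m: "m = Suc n" using assms gr0_implies_Suc by blast
  have term_eq: "(m choose Suc j) * (y ^ Suc j * forest_number (m - Suc j) x (Suc j * x)) =
    y * ((n choose j) * y ^ j * (m * x) ^ (n - j))" if "j \<le> n" for j
  proof (cases "j = n")
    case True
    then show ?thesis by (simp add: m forest_number_def)
  next
    case False
    then have nj: "n - j = Suc (n - Suc j)" using that by simp
    \<comment> \<open>All summands share the base \<open>m * x\<close>, since the roots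
      \<open>k * x\<close> make up for the removed cycles.\<close>
    have "(m - Suc j) * x + Suc j * x = (m - Suc j + Suc j) * x" by (rule add_mult_distrib[symmetric])
    also have "\<dots> = m * x" using that m by simp
    finally have "forest_number (m - Suc j) x (Suc j * x) = (m * x) ^ (n - Suc j) * (Suc j * x)"
      using nj m by (simp add: forest_number_def del: mult_Suc mult_Suc_right)
    then have "(m choose Suc j) * (y ^ Suc j * forest_number (m - Suc j) x (Suc j * x)) =
      (Suc j * (m choose Suc j)) * (y ^ Suc j * ((m * x) ^ (n - Suc j) * x))"
      by (simp only: mult.assoc mult.commute mult.left_commute)
    also have "Suc j * (m choose Suc j) = m * (n choose j)"
      using binomial_absorption[of j m] m by simp
    also have "m * (n choose j) * (y ^ Suc j * ((m * x) ^ (n - Suc j) * x)) =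
      y * ((n choose j) * y ^ j * ((m * x) * (m * x) ^ (n - Suc j)))"
      by (simp only: power_Suc mult.assoc mult.commute mult.left_commute)
    finally show ?thesis by (simp only: nj power_Suc)
  qed
  \<comment> \<open>The summand \<open>k = 0\<close> vanishes: a nonempty forest needs a
    root.\<close>
  have "(\<Sum>k\<le>m. (m choose k) * (y ^ k * forest_number (m - k) x (k * x))) =
    (\<Sum>j\<le>n. (m choose Suc j) * (y ^ Suc j * forest_number (m - Suc j) x (Suc j * x)))"
    using assms by (simp only: m sum.atMost_Suc_shift) (simp add: forest_number_def)
  also have "\<dots> = (\<Sum>j\<le>n. y * ((n choose j) * y ^ j * (m * x) ^ (n - j)))"
    by (rule sum.cong[OF refl], rule term_eq) simp
  also have "\<dots> = y * (y + m * x) ^ n"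
    by (simp add: binomial sum_distrib_left)
  finally show ?thesis by (simp add: forest_number_def m ac_simps)
qed

section \<open>Forests on cycles of one common length\<close>

lemma sum_Pow_card:
  assumes "finite A"
  shows "(\<Sum>B\<in>Pow A. f (card B)) = (\<Sum>k\<le>card A. (card A choose k) * (f k :: nat))"
proof -
  have "(\<Sum>B\<in>Pow A. f (card B)) = (\<Sum>k\<le>card A. \<Sum>B\<in>{B \<in> Pow A. card B = k}. f (card B))"
    by (rule sum.group[symmetric]) (use assms in \<open>auto intro: card_mono\<close>)
  also have "\<dots> = (\<Sum>k\<le>card A. (card A choose k) * f k)"
  proof (rule sum.cong[OF refl])
    fix k
    have "(\<Sum>B\<in>{B \<in> Pow A. card B = k}. f (card B)) = card {B \<in> Pow A. card B = k} * f k" by simp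
    also have "card {B \<in> Pow A. card B = k} = card A choose k"
      using n_subsets[OF assms, of k] by (simp add: Pow_def)
    finally show "(\<Sum>B\<in>{B \<in> Pow A. card B = k}. f (card B)) = (card A choose k) * f k" .
  qed
  finally show ?thesis .
qed

lemma rooted_on_Un_exit:
  assumes "rooted_on B p" and "\<And>v. v \<in> A \<Longrightarrow> p v \<notin> A \<union> B"
  shows "rooted_on (A \<union> B) p"
  unfolding rooted_on_def
proof (intro allI impI)
  fix X assume X: "X \<subseteq> A \<union> B" "X \<noteq> {}"
  show "\<exists>v\<in>X. p v \<notin> X"
  proof (cases "X \<inter> A = {}")
    case True
    then show ?thesis using X rooted_onD[OF assms(1), of X] by blast
  next
    case False
    then show ?thesis using X(1) assms(2) by blast
  qed
qed

text \<open>Without roots \<open>S\<close> itself is closed under parents. This settles the case in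
  which no cycle is attached to a root.\<close>

lemma equivariant_forests_no_roots:
  assumes "S \<noteq> {}"
  shows "equivariant_forests \<sigma> S {} = {}"
  using assms by (auto simp: equivariant_forests_def dest!: rooted_onD[of S _ S])

lemma finite_equivariant_forests:
  assumes "finite S" and "finite R"
  shows "finite (equivariant_forests \<sigma> S R)"
  unfolding equivariant_forests_def using assms by (simp add: finite_PiE)

text \<open>Since \<open>R\<close> is closed under \<open>\<sigma>\<close>, a cycle with one point
  sent into \<open>R\<close> is sent there entirely. Hence the cycles outside \<open>\<K>\<close>
  avoid \<open>R\<close> and form a forest whose roots are the points of
  \<open>\<Union>\<K>\<close>, independent of how \<open>\<K>\<close> is mapped to
  \<open>R\<close>.\<close>

lemma equivariant_forests_fibre:
  assumes perm: "permutation \<sigma>" and \<S>: "\<S> \<subseteq> range (orbit \<sigma>)" and \<K>: "\<K> \<subseteq> \<S>"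
    and R: "\<sigma> ` R \<subseteq> R" and disj: "R \<inter> \<Union>\<S> = {}"
  shows "{p \<in> equivariant_forests \<sigma> (\<Union>\<S>) R. {A \<in> \<S>. p ` A \<subseteq> R} = \<K>} =
    {p \<in> extensional (\<Union>\<K> \<union> \<Union>(\<S> - \<K>)).
       restrict p (\<Union>\<K>) \<in> {q \<in> \<Union>\<K> \<rightarrow>\<^sub>E R. equivariant_on \<sigma> (\<Union>\<K>) q} \<and>
       restrict p (\<Union>(\<S> - \<K>)) \<in> equivariant_forests \<sigma> (\<Union>(\<S> - \<K>)) (\<Union>\<K>)}" (is "?L = ?M")
proof -
  let ?A = "\<Union>\<K>" and ?B = "\<Union>(\<S> - \<K>)"
  have un: "\<Union>\<S> = ?A \<union> ?B" using \<K> by blast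
  have invA: "\<sigma> ` ?A \<subseteq> ?A" and invB: "\<sigma> ` ?B \<subseteq> ?B"
    using \<K> \<S> by (intro image_Union_orbits; blast)+
  have eqA: "equivariant_on \<sigma> ?A (restrict p ?A) \<longleftrightarrow> equivariant_on \<sigma> ?A p" for p
    by (rule equivariant_on_cong[OF _ invA]) simp
  have eqB: "equivariant_on \<sigma> ?B (restrict p ?B) \<longleftrightarrow> equivariant_on \<sigma> ?B p" for p
    by (rule equivariant_on_cong[OF _ invB]) simp
  have rootB: "rooted_on ?B (restrict p ?B) \<longleftrightarrow> rooted_on ?B p" for p
    by (rule rooted_on_cong) simp
  show ?thesis
  proof (intro equalityI subsetI)
    fix p assume "p \<in> ?L"
    then have p: "p \<in> \<Union>\<S> \<rightarrow>\<^sub>E \<Union>\<S> \<union> R" "equivariant_on \<sigma> (\<Union>\<S>) p" "rooted_on (\<Union>\<S>) p"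
      and \<K>p: "{A \<in> \<S>. p ` A \<subseteq> R} = \<K>"
      by (auto simp: equivariant_forests_def)
    have "p v \<in> R" if "v \<in> ?A" for v using that \<K>p by blast
    moreover have "p v \<in> ?A \<union> ?B" if v: "v \<in> ?B" for v
    proof -
      obtain A where A: "A \<in> \<S>" "A \<notin> \<K>" "v \<in> A" using v by blast
      then obtain u where u: "u \<in> A" "p u \<notin> R" using \<K>p by blast
      have "cyclic_on \<sigma> A" using A(1) \<S> cyclic_on_orbit'[OF perm] by blast
      then have "A = orbit \<sigma> v" using A(3) by (simp add: orbit_cyclic_eq3)
      \<comment> \<open>The point \<open>u\<close> with parent outside \<open>R\<close> is an
        iterate of \<open>v\<close>, so \<open>p v \<in> R\<close> would force
        \<open>p u \<in> R\<close>.\<close>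
      then obtain k where "u = (\<sigma> ^^ k) v"
        using u(1) by (auto simp: orbit_altdef_permutation[OF perm])
      then have "p u = (\<sigma> ^^ k) (p v)"
        using equivariant_on_funpow[OF p(2) image_Union_orbits[OF \<S>]] A by blast
      then have "p v \<notin> R" using u(2) funpow_image_subset[OF R] by metis
      moreover have "p v \<in> \<Union>\<S> \<union> R" using p(1) A by blast
      ultimately show ?thesis using un by blast
    qed
    moreover have "equivariant_on \<sigma> ?A p" "equivariant_on \<sigma> ?B p" "rooted_on ?B p"
      using p(2,3) un by (auto intro: equivariant_on_subset rooted_on_subset)
    moreover have "p \<in> extensional (?A \<union> ?B)" using p(1) un by (auto simp: PiE_def)
    ultimately show "p \<in> ?M"
      by (simp add: equivariant_forests_def eqA eqB rootB Pi_def Un_commute)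
  next
    fix p assume "p \<in> ?M"
    then have ext: "p \<in> extensional (?A \<union> ?B)"
      and A: "\<And>v. v \<in> ?A \<Longrightarrow> p v \<in> R" and B: "\<And>v. v \<in> ?B \<Longrightarrow> p v \<in> ?A \<union> ?B"
      and eq: "equivariant_on \<sigma> ?A p" "equivariant_on \<sigma> ?B p" and root: "rooted_on ?B p"
      by (auto simp: equivariant_forests_def eqA eqB rootB PiE_def Pi_def)
    have "p \<in> \<Union>\<S> \<rightarrow>\<^sub>E \<Union>\<S> \<union> R"
      using A B ext un by (simp add: PiE_def Pi_def) blast
    moreover have "equivariant_on \<sigma> (\<Union>\<S>) p"
      unfolding un using eq by (auto simp: equivariant_on_def)
    moreover have "rooted_on (\<Union>\<S>) p"
      unfolding un using root A disj un by (intro rooted_on_Un_exit) auto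
    moreover have "{A \<in> \<S>. p ` A \<subseteq> R} = \<K>"
    proof (intro equalityI subsetI)
      fix C assume "C \<in> \<K>"
      then have "C \<in> \<S>" and "p v \<in> R" if "v \<in> C" for v using A[of v] \<K> that by blast+
      then show "C \<in> {A \<in> \<S>. p ` A \<subseteq> R}" using \<open>C \<in> \<K>\<close> \<K> by auto
    next
      fix C assume C: "C \<in> {A \<in> \<S>. p ` A \<subseteq> R}"
      then obtain x where "C = orbit \<sigma> x" using \<S> by blast
      \<comment> \<open>Any point of \<open>C\<close> decides: its parent is in \<open>R\<close>,
        whereas points of \<open>\<Union>(\<S> - \<K>)\<close> have parents in
        \<open>\<Union>\<S>\<close>, disjoint from \<open>R\<close>.\<close>
      then obtain v where "v \<in> C" using orbit_nonempty[of \<sigma> x] by blast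
      then have "p v \<in> R" using C by blast
      then have "v \<notin> ?B" using B[of v] disj un by blast
      then show "C \<in> \<K>" using C \<open>v \<in> C\<close> by blast
    qed
    ultimately show "p \<in> ?L" by (simp add: equivariant_forests_def)
  qed
qed

text \<open>Induction on the set of cycles with varying roots. Sorting forests by the set
  \<open>\<K>\<close> of cycles attached to \<open>R\<close> gives \<open>card R ^ card \<K>\<close>
  attachments times the forests on the other cycles, now with \<open>card \<K> * d\<close> roots;
  \<open>forest_number_recurrence\<close> sums these products.\<close>

theorem card_equivariant_forests:
  assumes perm: "permutation \<sigma>" and fin: "finite \<S>" and \<S>: "\<S> \<subseteq> range (orbit \<sigma>)"
    and card: "\<And>A. A \<in> \<S> \<Longrightarrow> card A = d"
    and "finite R" and R: "\<sigma> ` R \<subseteq> R" and disj: "R \<inter> \<Union>\<S> = {}"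
    and dvd: "\<And>y. y \<in> R \<Longrightarrow> card (orbit \<sigma> y) dvd d"
  shows "card (equivariant_forests \<sigma> (\<Union>\<S>) R) = forest_number (card \<S>) d (card R)"
  using fin \<S> card \<open>finite R\<close> R disj dvd
proof (induction \<S> arbitrary: R rule: finite_psubset_induct)
  case (psubset \<S>)
  show ?case
  proof (cases "\<S> = {}")
    case True
    then show ?thesis
      by (simp add: equivariant_forests_def forest_number_def equivariant_on_def rooted_on_def)
  next
    case False
    let ?N = "equivariant_forests \<sigma> (\<Union>\<S>) R"
    have finN: "finite ?N"
      using finite_Union_orbits[OF perm psubset.hyps(1) psubset.prems(1)] psubset.prems(3)
      by (rule finite_equivariant_forests)
    have fibre: "card {p \<in> ?N. {A \<in> \<S>. p ` A \<subseteq> R} = \<K>} =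
      card R ^ card \<K> * forest_number (card \<S> - card \<K>) d (card \<K> * d)"
      if "\<K> \<in> Pow \<S>" for \<K>
    proof -
      have \<K>: "\<K> \<subseteq> \<S>" "finite \<K>" "\<K> \<subseteq> range (orbit \<sigma>)" "\<S> - \<K> \<subseteq> range (orbit \<sigma>)"
        using that psubset.hyps(1) psubset.prems(1) by (auto intro: finite_subset)
      have card\<K>: "\<And>A. A \<in> \<K> \<Longrightarrow> card A = d" and cardD: "\<And>A. A \<in> \<S> - \<K> \<Longrightarrow> card A = d"
        using \<K>(1) psubset.prems(2) by auto
      have dis: "\<Union>\<K> \<inter> \<Union>(\<S> - \<K>) = {}"
      proof (rule ccontr)
        assume "\<Union>\<K> \<inter> \<Union>(\<S> - \<K>) \<noteq> {}"
        then obtain A B where "A \<in> \<K>" "B \<in> \<S> - \<K>" "A \<inter> B \<noteq> {}" by blast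
        moreover from this have "A \<noteq> B" by blast
        ultimately show False using orbits_disjoint[OF perm, of A B] \<K> by blast
      qed
      have "card {p \<in> ?N. {A \<in> \<S>. p ` A \<subseteq> R} = \<K>} =
        card {q \<in> \<Union>\<K> \<rightarrow>\<^sub>E R. equivariant_on \<sigma> (\<Union>\<K>) q} *
        card (equivariant_forests \<sigma> (\<Union>(\<S> - \<K>)) (\<Union>\<K>))"
        unfolding equivariant_forests_fibre[OF perm psubset.prems(1) \<K>(1) psubset.prems(4,5)]
        by (rule card_extensional_two_pieces[OF dis])
          (auto simp: equivariant_forests_def PiE_def)
      also have "card {q \<in> \<Union>\<K> \<rightarrow>\<^sub>E R. equivariant_on \<sigma> (\<Union>\<K>) q} = card R ^ card \<K>"
        by (rule card_equivariant_on_orbits[OF perm \<K>(2,3) card\<K> psubset.prems(4,6)])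
      also have "card (equivariant_forests \<sigma> (\<Union>(\<S> - \<K>)) (\<Union>\<K>)) =
        forest_number (card \<S> - card \<K>) d (card \<K> * d)"
      proof (cases "\<K> = {}")
        \<comment> \<open>The induction hypothesis does not reach \<open>\<S> - {} = \<S>\<close>,
          but both sides are 0 as there are cycles and no roots.\<close>
        case True
        have "\<Union>\<S> \<noteq> {}" using False psubset.prems(1) orbit_nonempty[of \<sigma>] by blast
        moreover have "card \<S> \<noteq> 0" using False psubset.hyps(1) by simp
        ultimately show ?thesis
          using True equivariant_forests_no_roots[of "\<Union>\<S>" \<sigma>] by (simp add: forest_number_def)
      next
        case False
        have "card (equivariant_forests \<sigma> (\<Union>(\<S> - \<K>)) (\<Union>\<K>)) =
          forest_number (card (\<S> - \<K>)) d (card (\<Union>\<K>))"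
        proof (rule psubset.IH)
          show "\<S> - \<K> \<subset> \<S>" using False \<K>(1) by blast
          show "finite (\<Union>\<K>)" using finite_Union_orbits[OF perm \<K>(2,3)] .
          show "\<sigma> ` \<Union>\<K> \<subseteq> \<Union>\<K>" using image_Union_orbits[OF \<K>(3)] .
          \<comment> \<open>The new roots lie on cycles of length exactly \<open>d\<close>.\<close>
          show "card (orbit \<sigma> y) dvd d" if y: "y \<in> \<Union>\<K>" for y
          proof -
            obtain A where A: "A \<in> \<K>" "y \<in> A" using y by blast
            then have "cyclic_on \<sigma> A" using \<K>(3) cyclic_on_orbit'[OF perm] by blast
            then have "orbit \<sigma> y = A" using A(2) by (rule orbit_cyclic_eq3)
            then show ?thesis using card\<K>[OF A(1)] by simp
          qed
        qed (use \<K>(4) cardD dis in auto)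
        then show ?thesis
          using card_Union_orbits[OF perm \<K>(3) card\<K>] card_Diff_subset[OF \<K>(2,1)] by simp
      qed
      finally show ?thesis .
    qed
    have "card ?N = (\<Sum>\<K>\<in>Pow \<S>. card {p \<in> ?N. {A \<in> \<S>. p ` A \<subseteq> R} = \<K>})"
      using sum.group[of ?N "Pow \<S>" "\<lambda>p. {A \<in> \<S>. p ` A \<subseteq> R}" "\<lambda>_. 1::nat"] finN psubset.hyps(1)
      by (simp add: image_subset_iff)
    also have "\<dots> = (\<Sum>\<K>\<in>Pow \<S>. card R ^ card \<K> * forest_number (card \<S> - card \<K>) d (card \<K> * d))"
      by (rule sum.cong[OF refl]) (rule fibre)
    also have "\<dots> = (\<Sum>k\<le>card \<S>. (card \<S> choose k) *
        (card R ^ k * forest_number (card \<S> - k) d (k * d)))"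
      by (rule sum_Pow_card[OF psubset.hyps(1)])
    also have "\<dots> = forest_number (card \<S>) d (card R)"
      using False psubset.hyps(1) by (intro forest_number_recurrence) (simp add: card_gt_0_iff)
    finally show ?thesis .
  qed
qed

text \<open>An equivariant map sends points fixed by \<open>\<sigma> ^^ d\<close> to such points, so
  the parent's cycle length divides that of the child, and \<open>p\<close> splits into one forest
  per length. Conversely any choice of pieces glues to a rooted map, because cycle lengths never
  grow towards the root.\<close>

lemma equivariant_forests_by_orbit_size:
  fixes \<sigma> :: "'a \<Rightarrow> 'a" and S :: "'a set"
  defines "D \<equiv> \<lambda>d. {v \<in> S. card (orbit \<sigma> v) = d}"
  assumes perm: "permutation \<sigma>" and inv: "\<sigma> ` S \<subseteq> S" and "r \<notin> S"
    and "finite I" and I: "\<And>v. v \<in> S \<Longrightarrow> card (orbit \<sigma> v) \<in> I"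
  shows "card (equivariant_forests \<sigma> S {r}) =
    (\<Prod>d\<in>I. card (equivariant_forests \<sigma> (D d) ({v \<in> insert r S. card (orbit \<sigma> v) dvd d} - D d)))"
proof -
  let ?R = "\<lambda>d. {v \<in> insert r S. card (orbit \<sigma> v) dvd d} - D d"
  have S: "S = (\<Union>d\<in>I. D d)" using I by (auto simp: D_def)
  have invD: "\<sigma> ` D d \<subseteq> D d" for d
    using inv permutation_orbit_step[OF perm] by (auto simp: D_def)
  have eqD: "equivariant_on \<sigma> (D d) (restrict p (D d)) \<longleftrightarrow> equivariant_on \<sigma> (D d) p" for p d
    by (rule equivariant_on_cong[OF _ invD]) simp
  have rootD: "rooted_on (D d) (restrict p (D d)) \<longleftrightarrow> rooted_on (D d) p" for p d
    by (rule rooted_on_cong) simp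
  have "equivariant_forests \<sigma> S {r} =
    {p \<in> extensional (\<Union>d\<in>I. D d). \<forall>d\<in>I. restrict p (D d) \<in> equivariant_forests \<sigma> (D d) (?R d)}"
  proof (intro equalityI subsetI)
    fix p assume "p \<in> equivariant_forests \<sigma> S {r}"
    then have p: "p \<in> S \<rightarrow>\<^sub>E insert r S" "equivariant_on \<sigma> S p" "rooted_on S p"
      by (auto simp: equivariant_forests_def)
    have "restrict p (D d) \<in> equivariant_forests \<sigma> (D d) (?R d)" for d
    proof -
      have "p v \<in> D d \<union> ?R d" if "v \<in> D d" for v
      proof -
        have v: "v \<in> S" "(\<sigma> ^^ d) v = v"
          using that card_orbit_dvd_iff[OF perm, of v d] by (auto simp: D_def)
        then have "(\<sigma> ^^ d) (p v) = p v" using equivariant_on_funpow[OF p(2) inv v(1), of d] by simp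
        then have "card (orbit \<sigma> (p v)) dvd d" using card_orbit_dvd_iff[OF perm] by blast
        then show ?thesis using p(1) v(1) by auto
      qed
      moreover have "D d \<subseteq> S" by (auto simp: D_def)
      ultimately show ?thesis
        using equivariant_on_subset[OF p(2)] rooted_on_subset[OF p(3)]
        by (simp add: equivariant_forests_def eqD rootD)
    qed
    moreover have "p \<in> extensional (\<Union>d\<in>I. D d)" using p(1) S by (simp add: PiE_def)
    ultimately show "p \<in> {p \<in> extensional (\<Union>d\<in>I. D d).
      \<forall>d\<in>I. restrict p (D d) \<in> equivariant_forests \<sigma> (D d) (?R d)}" by simp
  next
    fix p assume "p \<in> {p \<in> extensional (\<Union>d\<in>I. D d).
      \<forall>d\<in>I. restrict p (D d) \<in> equivariant_forests \<sigma> (D d) (?R d)}"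
    then have ext: "p \<in> extensional S"
      and p: "\<And>d. d \<in> I \<Longrightarrow> restrict p (D d) \<in> equivariant_forests \<sigma> (D d) (?R d)"
      using S by auto
    have eq: "equivariant_on \<sigma> (D d) p" and root: "rooted_on (D d) p" if "d \<in> I" for d
      using p[OF that] by (auto simp: equivariant_forests_def eqD rootD)
    have val: "p v \<in> insert r S \<and> card (orbit \<sigma> (p v)) dvd card (orbit \<sigma> v)" if v: "v \<in> S" for v
    proof -
      let ?d = "card (orbit \<sigma> v)"
      have vD: "v \<in> D ?d" using v by (simp add: D_def)
      have "restrict p (D ?d) \<in> D ?d \<rightarrow>\<^sub>E D ?d \<union> ?R ?d"
        using p[OF I[OF v]] by (simp add: equivariant_forests_def)
      then have "restrict p (D ?d) v \<in> D ?d \<union> ?R ?d" using vD by (rule PiE_mem)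
      then have "p v \<in> D ?d \<union> ?R ?d" using vD by simp
      then show ?thesis by (auto simp: D_def)
    qed
    have "equivariant_on \<sigma> S p"
      unfolding equivariant_on_def
    proof
      fix v assume v: "v \<in> S"
      then have "v \<in> D (card (orbit \<sigma> v))" by (simp add: D_def)
      then show "p (\<sigma> v) = \<sigma> (p v)" using eq[OF I[OF v]] unfolding equivariant_on_def by blast
    qed
    moreover have "rooted_on S p"
      unfolding rooted_on_def
    proof (intro allI impI)
      fix X assume X: "X \<subseteq> S" "X \<noteq> {}"
      \<comment> \<open>Rootedness is tested on the points of \<open>X\<close> of least cycle length
        \<open>d\<close>. A parent still in \<open>X\<close> would have length dividing
        \<open>d\<close> and at least \<open>d\<close>, so it would stay in
        \<open>D d\<close>.\<close>
      define d where "d = (LEAST d. \<exists>v\<in>X. card (orbit \<sigma> v) = d)"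
      have "\<exists>v\<in>X. card (orbit \<sigma> v) = d"
        unfolding d_def by (rule LeastI_ex) (use X in blast)
      then have ne: "X \<inter> D d \<noteq> {}" and "d \<in> I" using X I by (auto simp: D_def)
      have least: "d \<le> card (orbit \<sigma> v)" if "v \<in> X" for v
        unfolding d_def by (rule Least_le) (use that in blast)
      obtain v where v: "v \<in> X" "v \<in> D d" "p v \<notin> X \<inter> D d"
        using rooted_onD[OF root[OF \<open>d \<in> I\<close>] _ ne] by blast
      have "p v \<notin> X"
      proof
        assume pv: "p v \<in> X"
        have "v \<in> S" and d: "card (orbit \<sigma> v) = d" using v(2) by (auto simp: D_def)
        then have "card (orbit \<sigma> (p v)) dvd d" using val[of v] by simp
        then have "card (orbit \<sigma> (p v)) \<le> d"
          using card_orbit_pos[OF perm, of v] d by (simp add: dvd_imp_le)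
        then have "p v \<in> D d" using least[OF pv] pv X(1) by (auto simp: D_def)
        then show False using v(3) pv by blast
      qed
      then show "\<exists>v\<in>X. p v \<notin> X" using v(1) by blast
    qed
    moreover have "p \<in> S \<rightarrow>\<^sub>E S \<union> {r}" using val ext by (auto simp: PiE_def)
    ultimately show "p \<in> equivariant_forests \<sigma> S {r}" by (simp add: equivariant_forests_def)
  qed
  also have "card \<dots> = (\<Prod>d\<in>I. card (equivariant_forests \<sigma> (D d) (?R d)))"
    by (rule card_extensional_pieces[OF \<open>finite I\<close>])
      (auto simp: D_def equivariant_forests_def PiE_def)
  finally show ?thesis .
qed

section \<open>Orbit classes and the numbers in the formula\<close>

lemma Union_orbits_of_size:
  assumes "permutation \<sigma>" and "\<sigma> ` V \<subseteq> V"
  shows "\<Union>(orbit \<sigma> ` {v \<in> V. card (orbit \<sigma> v) = d}) = {v \<in> V. card (orbit \<sigma> v) = d}"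
proof (intro equalityI subsetI)
  fix u assume "u \<in> \<Union>(orbit \<sigma> ` {v \<in> V. card (orbit \<sigma> v) = d})"
  then obtain v where v: "v \<in> V" "card (orbit \<sigma> v) = d" "u \<in> orbit \<sigma> v" by blast
  obtain k where "u = (\<sigma> ^^ k) v" using v(3) by (auto simp: orbit_altdef)
  then have "u \<in> V" using funpow_image_subset[OF assms(2) v(1)] by simp
  moreover have "orbit \<sigma> u = orbit \<sigma> v"
    using v(3) cyclic_on_orbit'[OF assms(1)] by (simp add: orbit_cyclic_eq3)
  ultimately show "u \<in> {v \<in> V. card (orbit \<sigma> v) = d}" using v(2) by simp
next
  fix u assume "u \<in> {v \<in> V. card (orbit \<sigma> v) = d}"
  then show "u \<in> \<Union>(orbit \<sigma> ` {v \<in> V. card (orbit \<sigma> v) = d})"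
    using permutation_self_in_orbit[OF assms(1)] by blast
qed

lemma num_cycles_eq:
  "num_cycles n \<sigma> d = card (orbit \<sigma> ` {v \<in> {1..n}. card (orbit \<sigma> v) = d})"
  unfolding num_cycles_def by (rule arg_cong[where f = card]) auto

lemma card_points_of_size:
  assumes "\<sigma> permutes {1..n}"
  shows "card {v \<in> {1..n}. card (orbit \<sigma> v) = d} = num_cycles n \<sigma> d * d"
proof -
  have perm: "permutation \<sigma>" using assms by (auto simp: permutation_permutes)
  have inv: "\<sigma> ` {1..n} \<subseteq> {1..n}" using permutes_image[OF assms] by simp
  have "card (\<Union>(orbit \<sigma> ` {v \<in> {1..n}. card (orbit \<sigma> v) = d})) = num_cycles n \<sigma> d * d"
    unfolding num_cycles_eq by (rule card_Union_orbits[OF perm]) auto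
  then show ?thesis by (simp only: Union_orbits_of_size[OF perm inv])
qed

text \<open>Each cycle of length \<open>e\<close> contributes \<open>e\<close> points. This
  identifies \<open>mu\<close> with the number of available roots for the cycles of length
  \<open>d\<close>.\<close>

lemma mu_eq_card:
  assumes "\<sigma> permutes {1..n}" and "0 < d"
  shows "mu n \<sigma> d = card {v \<in> {1..n}. card (orbit \<sigma> v) dvd d \<and> card (orbit \<sigma> v) < d}"
proof -
  let ?E = "{e. e dvd d \<and> e < d}"
  have "{v \<in> {1..n}. card (orbit \<sigma> v) dvd d \<and> card (orbit \<sigma> v) < d} =
    (\<Union>e\<in>?E. {v \<in> {1..n}. card (orbit \<sigma> v) = e})" by auto
  also have "card \<dots> = (\<Sum>e\<in>?E. card {v \<in> {1..n}. card (orbit \<sigma> v) = e})"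
    by (rule card_UN_disjoint) auto
  also have "\<dots> = (\<Sum>e\<in>?E. e * num_cycles n \<sigma> e)"
    by (rule sum.cong[OF refl]) (simp only: card_points_of_size[OF assms(1)] mult.commute)
  finally show ?thesis by (simp add: mu_def)
qed

lemma tree_factor_eq_forest_number:
  assumes "0 < m"
  shows "tree_factor (int m) (int x) (int y) = of_nat (forest_number m x y)"
proof -
  have "int m - 1 = int (m - 1)" using assms by simp
  then have "tree_factor (int m) (int x) (int y) = of_int (int m * int x + int y) ^ (m - 1) * of_int (int y)"
    unfolding tree_factor_def by (simp only: power_int_of_nat)
  then show ?thesis using assms by (simp add: forest_number_def)
qed

text \<open>The fixed points other than 1 are \<open>m\<close> cycles of length 1 with the single
  root 1. For \<open>m = 0\<close> the negative exponent is harmless, as the base is 1.\<close>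

lemma power_int_eq_forest_number:
  "(of_nat (Suc m) :: rat) powi (int (Suc m) - 2) = of_nat (forest_number m 1 1)"
proof (cases m)
  case (Suc k)
  have "int (Suc m) - 2 = int k" using Suc by simp
  then have "(of_nat (Suc m) :: rat) powi (int (Suc m) - 2) = of_nat (Suc m) ^ k"
    by (simp only: power_int_of_nat)
  then show ?thesis by (simp add: forest_number_def Suc)
qed (simp add: forest_number_def)

section \<open>Assembling the product over cycle lengths\<close>

theorem mainTheorem1:
  fixes n :: nat and \<sigma> :: "nat \<Rightarrow> nat"
  assumes "n \<ge> 1"
    and "\<sigma> permutes {1..n}"
    and "\<sigma> 1 = 1"
  shows "(of_nat (card {(E, r) \<in> rooted_labeled_trees n 1. invariant_edges \<sigma> E}) :: rat) =
    of_nat (num_cycles n \<sigma> 1) powi (int (num_cycles n \<sigma> 1) - 2) *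
    (\<Prod>d | 2 \<le> d \<and> num_cycles n \<sigma> d \<noteq> 0.
       tree_factor (int (num_cycles n \<sigma> d)) (int d) (int (mu n \<sigma> d)))"
proof -
  define S where "S = {1..n} - {1}"
  have V: "{1..n} = insert 1 S" and "1 \<notin> S" and "finite S" using assms(1) by (auto simp: S_def)
  have perm: "permutation \<sigma>" using assms(2) by (auto simp: permutation_permutes)
  have invV: "\<sigma> ` {1..n} \<subseteq> {1..n}" using permutes_image[OF assms(2)] by simp
  have invS: "\<sigma> ` S \<subseteq> S"
  proof
    fix u assume "u \<in> \<sigma> ` S"
    then obtain v where v: "u = \<sigma> v" "v \<in> {1..n}" "v \<noteq> 1"
      unfolding S_def by blast
    then have "\<sigma> v \<noteq> \<sigma> 1" using permutes_inj[OF assms(2)] by (simp only: inj_eq not_False_eq_True)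
    moreover have "\<sigma> v \<in> {1..n}" using v(2) invV by blast
    ultimately show "u \<in> S" using v(1) assms(3) unfolding S_def by simp
  qed
  have orbit1: "orbit \<sigma> 1 = {1}" using assms(3) by (simp add: orbit_eq_singleton_iff)
  define D where "D d = {v \<in> S. card (orbit \<sigma> v) = d}" for d
  \<comment> \<open>As 1 is a fixed point, it belongs to \<open>R d\<close> for every
    \<open>d\<close>, and \<open>R 1\<close> is just \<open>{1}\<close>.\<close>
  define R where "R d = {v \<in> insert 1 S. card (orbit \<sigma> v) dvd d} - D d" for d
  define I where "I = {d. 2 \<le> d \<and> num_cycles n \<sigma> d \<noteq> 0}"

  have size_in_I: "card (orbit \<sigma> v) \<in> insert 1 I" if "v \<in> S" for v
  proof -
    have "orbit \<sigma> v \<in> orbit \<sigma> ` {u \<in> {1..n}. card (orbit \<sigma> u) = card (orbit \<sigma> v)}"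
      using that V by blast
    then have "num_cycles n \<sigma> (card (orbit \<sigma> v)) \<noteq> 0"
      unfolding num_cycles_eq by auto
    then show ?thesis using card_orbit_pos[OF perm, of v] by (auto simp: I_def)
  qed
  have "I \<subseteq> (\<lambda>v. card (orbit \<sigma> v)) ` {1..n}"
  proof
    fix d assume "d \<in> I"
    then have "{v \<in> {1..n}. card (orbit \<sigma> v) = d} \<noteq> {}"
      by (auto simp: I_def num_cycles_eq)
    then show "d \<in> (\<lambda>v. card (orbit \<sigma> v)) ` {1..n}" by blast
  qed
  then have "finite I" using finite_subset by blast
  have "1 \<notin> I" by (simp add: I_def)

  have piece: "card (equivariant_forests \<sigma> (D d) (R d)) =
    forest_number (card (orbit \<sigma> ` D d)) d (card (R d))" for d
  proof -
    have "card (equivariant_forests \<sigma> (\<Union>(orbit \<sigma> ` D d)) (R d)) =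
      forest_number (card (orbit \<sigma> ` D d)) d (card (R d))"
    proof (rule card_equivariant_forests[OF perm])
      show "\<sigma> ` R d \<subseteq> R d"
      proof
        fix u assume "u \<in> \<sigma> ` R d"
        then obtain v where v: "u = \<sigma> v" "v \<in> R d" by blast
        have "u \<in> insert 1 S" using v invV V by (auto simp: R_def)
        moreover have "orbit \<sigma> u = orbit \<sigma> v" using v(1) permutation_orbit_step[OF perm] by simp
        moreover have "u \<in> S \<longleftrightarrow> v \<in> S"
        proof (cases "v = 1")
          case True
          then show ?thesis using v(1) assms(3) by simp
        next
          case False
          then have "v \<in> S" using v(2) by (simp add: R_def)
          then show ?thesis using v(1) invS by blast
        qed
        ultimately show "u \<in> R d" using v(2) by (auto simp: R_def D_def)
      qed
      show "R d \<inter> \<Union>(orbit \<sigma> ` D d) = {}"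
        using Union_orbits_of_size[OF perm invS] by (auto simp: R_def D_def)
    qed (use \<open>finite S\<close> in \<open>auto simp: D_def R_def\<close>)
    then show ?thesis using Union_orbits_of_size[OF perm invS] by (simp add: D_def)
  qed

  \<comment> \<open>The cycle count at length 1 includes the root, so \<open>D 1\<close> carries one
    cycle fewer.\<close>
  have at_1: "of_nat (num_cycles n \<sigma> 1) powi (int (num_cycles n \<sigma> 1) - 2) =
    (of_nat (card (equivariant_forests \<sigma> (D 1) (R 1))) :: rat)"
  proof -
    have "card (orbit \<sigma> 1) = 1" using orbit1 by simp
    then have "{v \<in> {1..n}. card (orbit \<sigma> v) = 1} = insert 1 (D 1)"
      unfolding V D_def by blast
    then have "num_cycles n \<sigma> 1 = card (insert {1} (orbit \<sigma> ` D 1))"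
      by (simp only: num_cycles_eq image_insert orbit1)
    moreover have "{1} \<notin> orbit \<sigma> ` D 1"
    proof
      assume "{1} \<in> orbit \<sigma> ` D 1"
      then obtain v where "v \<in> S" "orbit \<sigma> v = {1}" unfolding D_def by blast
      then show False using permutation_self_in_orbit[OF perm, of v] \<open>1 \<notin> S\<close> by simp
    qed
    moreover have "finite (D 1)" using \<open>finite S\<close> by (simp add: D_def)
    ultimately have "num_cycles n \<sigma> 1 = Suc (card (orbit \<sigma> ` D 1))" by simp
    moreover have "R 1 = {1}"
    proof (intro equalityI subsetI)
      fix v assume "v \<in> R 1"
      then have "v = 1 \<or> v \<in> S" "card (orbit \<sigma> v) = 1" "v \<notin> D 1"
        unfolding R_def by simp_all
      then show "v \<in> {1}" unfolding D_def by blast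
    next
      fix v :: nat assume "v \<in> {1}"
      then show "v \<in> R 1" using \<open>1 \<notin> S\<close> orbit1 unfolding R_def D_def by simp
    qed
    ultimately show ?thesis
      using piece[of 1] power_int_eq_forest_number[of "card (orbit \<sigma> ` D 1)"] by simp
  qed
  \<comment> \<open>For \<open>d \<ge> 2\<close> removing the root 1 loses no point of cycle length
    \<open>d\<close>, and \<open>R d\<close> is the set counted by \<open>mu\<close>.\<close>
  have at_d: "tree_factor (int (num_cycles n \<sigma> d)) (int d) (int (mu n \<sigma> d)) =
    of_nat (card (equivariant_forests \<sigma> (D d) (R d)))" if "d \<in> I" for d
  proof -
    have d: "2 \<le> d" "0 < num_cycles n \<sigma> d" using that by (auto simp: I_def)
    have "{v \<in> {1..n}. card (orbit \<sigma> v) = d} = D d"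
    proof -
      have "card (orbit \<sigma> 1) \<noteq> d" using orbit1 d(1) by simp
      then show ?thesis unfolding V D_def by blast
    qed
    from this have num: "num_cycles n \<sigma> d = card (orbit \<sigma> ` D d)" by (simp add: num_cycles_eq)
    have "R d = {v \<in> {1..n}. card (orbit \<sigma> v) dvd d \<and> card (orbit \<sigma> v) < d}"
    proof (intro equalityI subsetI)
      fix v assume v: "v \<in> R d"
      then have "v \<in> {1..n}" "card (orbit \<sigma> v) dvd d" using V by (simp_all add: R_def)
      moreover from this have "card (orbit \<sigma> v) \<le> d" using d(1) by (simp add: dvd_imp_le)
      moreover have "card (orbit \<sigma> v) \<noteq> d"
        using v \<open>_ = D d\<close> \<open>v \<in> {1..n}\<close> unfolding R_def by blast
      ultimately show "v \<in> {v \<in> {1..n}. card (orbit \<sigma> v) dvd d \<and> card (orbit \<sigma> v) < d}" by simp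
    next
      fix v assume "v \<in> {v \<in> {1..n}. card (orbit \<sigma> v) dvd d \<and> card (orbit \<sigma> v) < d}"
      then show "v \<in> R d" unfolding R_def D_def V by simp
    qed
    then have "mu n \<sigma> d = card (R d)" using mu_eq_card[OF assms(2)] d(1) by simp
    then show ?thesis using tree_factor_eq_forest_number[OF d(2)] piece num by simp
  qed

  have "{(E, r) \<in> rooted_labeled_trees n 1. invariant_edges \<sigma> E} =
    (\<lambda>E. (E, 1)) ` {E. tree_on (insert 1 S) E \<and> invariant_edges \<sigma> E}"
  proof -
    have "1 \<in> {1..n}" using assms(1) by simp
    then show ?thesis unfolding V[symmetric] rooted_labeled_trees_def by blast
  qed
  then have "card {(E, r) \<in> rooted_labeled_trees n 1. invariant_edges \<sigma> E} =
    card {E. tree_on (insert 1 S) E \<and> invariant_edges \<sigma> E}"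
    by (simp add: card_image inj_on_def)
  also have "\<dots> = card (equivariant_forests \<sigma> S {1})"
    by (rule card_invariant_trees) (use assms(2,3) V \<open>1 \<notin> S\<close> in simp_all)
  \<comment> \<open>Length 1 is included even if 1 is the only fixed point; then \<open>D 1\<close>
    is empty and the factor is 1.\<close>
  also have "\<dots> = (\<Prod>d\<in>insert 1 I. card (equivariant_forests \<sigma> (D d) (R d)))"
    unfolding D_def R_def
    using \<open>finite I\<close>
    by (intro equivariant_forests_by_orbit_size[OF perm invS \<open>1 \<notin> S\<close> _ size_in_I]) simp_all
  also have "\<dots> = card (equivariant_forests \<sigma> (D 1) (R 1)) *
    (\<Prod>d\<in>I. card (equivariant_forests \<sigma> (D d) (R d)))"
    using \<open>finite I\<close> \<open>1 \<notin> I\<close> by simp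
  finally show ?thesis
    unfolding I_def[symmetric] at_1 by (simp add: at_d)
qed

end
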